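(* Suppose that axioms (A1), (A2) and (A3) (stated in the context) are satisfied. Then the unique substance $S$ is infinite, in the sense that it is not contained in any other substance: there is no substance $\Lambda$ with $\Lambda\neq S$ and $S\subseteq\Lambda$.
   Context: Time is modelled by $\mathbb{R}$. For each $t\in\mathbb{R}$, $E_t$ is a set (everything existing or having existed before time $t$), and $E_t\subseteq E_{t'}$ whenever $t\le t'$. $\mathcal{P}(E_t)$ is the power set of $E_t$, ordered by inclusion. The law of causality is a time-independent rule $\mathcal{C}$ assigning to every $A\in\bigcup_{t\in\mathbb{R}}\mathcal{P}(E_t)$ a set $\mathcal{C}(A)$ (the cause of $A$), not depending on $t$, with $\mathcal{C}(A)\in\mathcal{P}(E_t)$ whenever $A\in\mathcal{P}(E_t)$. Axiom (A1): for every $t\in\mathbb{R}$, $\mathcal{C}$ restricts to a map $\mathcal{P}(E_t)\to\mathcal{P}(E_t)\setminus\{\emptyset\}$ (every cause is nonempty). Axiom (A2): for every $t\in\mathbb{R}$ and all $A,B\in\mathcal{P}(E_t)$, if $A\subseteq B$ then $\mathcal{C}(A)\subseteq\mathcal{C}(B)$. A substance is a set $S\subseteq E_t$, for some $t\in\mathbb{R}$, such that $\mathcal{C}(S)=S$. Axiom (A3): two different substances have nothing in common, i.e. if $S,S'$ are substances and $S\neq S'$ then $S\cap S'=\emptyset$. Under (A1)--(A3) there is exactly one substance. "Infinite" here does not refer to cardinality: a thing is finite in its kind if it can be bounded by another thing of the same nature, so a substance is infinite if it is not contained in another substance. *)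

theory Defs
  imports Complex_Main
begin

text \<open>
  \<open>E t\<close> is the set of everything existing or having existed before time \<open>t\<close>.  The law of causality
  \<open>C\<close> is a single function, since it does not depend on time.  Nothing is required of its values on
  sets that are not contained in some \<open>E t\<close>.
\<close>

definition causal_world :: "(real \<Rightarrow> 'a set) \<Rightarrow> ('a set \<Rightarrow> 'a set) \<Rightarrow> bool" where
  "causal_world E C \<longleftrightarrow>
     (\<forall>t t'. t \<le> t' \<longrightarrow> E t \<subseteq> E t') \<and> (\<forall>t. \<forall>A\<in>Pow (E t). C A \<in> Pow (E t))"

definition axiom_A1 :: "(real \<Rightarrow> 'a set) \<Rightarrow> ('a set \<Rightarrow> 'a set) \<Rightarrow> bool" where
  "axiom_A1 E C \<longleftrightarrow> (\<forall>t. \<forall>A\<in>Pow (E t). C A \<in> Pow (E t) - {{}})"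

definition axiom_A2 :: "(real \<Rightarrow> 'a set) \<Rightarrow> ('a set \<Rightarrow> 'a set) \<Rightarrow> bool" where
  "axiom_A2 E C \<longleftrightarrow> (\<forall>t. \<forall>A\<in>Pow (E t). \<forall>B\<in>Pow (E t). A \<subseteq> B \<longrightarrow> C A \<subseteq> C B)"

definition substance :: "(real \<Rightarrow> 'a set) \<Rightarrow> ('a set \<Rightarrow> 'a set) \<Rightarrow> 'a set \<Rightarrow> bool" where
  "substance E C S \<longleftrightarrow> (\<exists>t. S \<subseteq> E t) \<and> C S = S"

definition axiom_A3 :: "(real \<Rightarrow> 'a set) \<Rightarrow> ('a set \<Rightarrow> 'a set) \<Rightarrow> bool" where
  "axiom_A3 E C \<longleftrightarrow>
     (\<forall>S S'. substance E C S \<and> substance E C S' \<and> S \<noteq> S' \<longrightarrow> S \<inter> S' = {})"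

text \<open>Not to be confused with infinite cardinality: \<open>S\<close> is not bounded by another substance.\<close>

definition infinite_in_kind :: "(real \<Rightarrow> 'a set) \<Rightarrow> ('a set \<Rightarrow> 'a set) \<Rightarrow> 'a set \<Rightarrow> bool" where
  "infinite_in_kind E C S \<longleftrightarrow> \<not> (\<exists>\<Lambda>. substance E C \<Lambda> \<and> \<Lambda> \<noteq> S \<and> S \<subseteq> \<Lambda>)"

end

theory Submission
  imports Defs
begin

text \<open>
  Everything rests on the Knaster--Tarski fixed point theorem: by (A2) the law of causality is a
  monotone map of the complete lattice of subsets of \<open>E t\<close> into itself, so every \<open>A \<subseteq> E t\<close> with
  \<open>A \<subseteq> C A\<close> lies below a fixed point, that is, inside a substance
  (\<open>post_fixed_set_in_substance\<close>).  For \<open>A = {}\<close> this produces a substance.  For \<open>A = S \<union> S'\<close>, with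
  \<open>S\<close> and \<open>S'\<close> substances, it produces a substance \<open>\<Lambda>\<close> that contains both.  Substances are nonempty
  by (A1), so \<open>\<Lambda>\<close> meets \<open>S\<close> and \<open>S'\<close>, and (A3) forces \<open>S = \<Lambda> = S'\<close>.  The only substance cannot be
  bounded by another one, because there is no other.
\<close>

text \<open>
  The library's greatest fixed point lives on the lattice of all sets, whereas \<open>C\<close> is controlled only
  on subsets of \<open>E t\<close>.  Precomposing with the intersection with \<open>E t\<close> gives a map that is monotone
  everywhere, has its values inside \<open>E t\<close>, and therefore has as fixed points exactly those of \<open>C\<close>
  inside \<open>E t\<close>.
\<close>

lemma post_fixed_set_in_substance:
  assumes "causal_world E C" and "axiom_A2 E C"
    and "A \<subseteq> E t" and "A \<subseteq> C A"
  shows "\<exists>\<Lambda>. substance E C \<Lambda> \<and> A \<subseteq> \<Lambda>"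
proof -
  define F where "F X = C (X \<inter> E t)" for X
  have "mono F"
  proof (rule monoI)
    fix X Y :: "'a set"
    assume "X \<subseteq> Y"
    then have "X \<inter> E t \<subseteq> Y \<inter> E t" by blast
    with \<open>axiom_A2 E C\<close> show "F X \<subseteq> F Y"
      unfolding F_def axiom_A2_def by (metis Int_lower2 PowI)
  qed
  then have fixed: "F (gfp F) = gfp F"
    by (rule gfp_fixpoint)
  have "F X \<subseteq> E t" for X
    using \<open>causal_world E C\<close> unfolding F_def causal_world_def by (metis Int_lower2 PowD PowI)
  with fixed have inside: "gfp F \<subseteq> E t"
    by metis
  with fixed have "C (gfp F) = gfp F"
    by (simp add: F_def Int_absorb2)
  with inside have "substance E C (gfp F)"
    unfolding substance_def by blast
  moreover have "A \<subseteq> gfp F"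
    using assms(3,4) by (intro gfp_upperbound) (simp add: F_def Int_absorb2)
  ultimately show ?thesis by blast
qed

lemma substance_nonempty:
  assumes "axiom_A1 E C" and "substance E C S"
  shows "S \<noteq> {}"
  using assms unfolding axiom_A1_def substance_def by fastforce

lemma substances_in_common_substance:
  assumes "causal_world E C" and "axiom_A2 E C"
    and "substance E C S" and "substance E C S'"
  shows "\<exists>\<Lambda>. substance E C \<Lambda> \<and> S \<subseteq> \<Lambda> \<and> S' \<subseteq> \<Lambda>"
proof -
  obtain s s' where "S \<subseteq> E s" "S' \<subseteq> E s'" and fixed: "C S = S" "C S' = S'"
    using assms(3,4) unfolding substance_def by blast
  \<comment> \<open>\<open>S\<close> and \<open>S'\<close> may be substances by virtue of different times; (A2) compares them only inside one
    and the same \<open>E t\<close>.\<close>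
  moreover have "E s \<subseteq> E (max s s')" "E s' \<subseteq> E (max s s')"
    using \<open>causal_world E C\<close> unfolding causal_world_def by simp_all
  ultimately have sub: "S \<subseteq> E (max s s')" "S' \<subseteq> E (max s s')"
    by blast+
  then have union: "S \<union> S' \<subseteq> E (max s s')" by blast
  have "C S \<subseteq> C (S \<union> S')" "C S' \<subseteq> C (S \<union> S')"
    using \<open>axiom_A2 E C\<close> sub union unfolding axiom_A2_def by (meson PowI Un_upper1 Un_upper2)+
  then have "S \<union> S' \<subseteq> C (S \<union> S')"
    using fixed by blast
  from post_fixed_set_in_substance[OF assms(1,2) union this] show ?thesis
    by blast
qed

lemma substance_eq_of_subset:
  assumes "axiom_A1 E C" and "axiom_A3 E C"
    and "substance E C S" and "substance E C \<Lambda>" and "S \<subseteq> \<Lambda>"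
  shows "S = \<Lambda>"
  using assms substance_nonempty[OF assms(1,3)] unfolding axiom_A3_def
  by (metis Int_absorb2)

theorem corollary2:
  fixes E :: "real \<Rightarrow> 'a set" and C :: "'a set \<Rightarrow> 'a set"
  assumes "causal_world E C"
    and "axiom_A1 E C"
    and "axiom_A2 E C"
    and "axiom_A3 E C"
  shows "(\<exists>!S. substance E C S) \<and> infinite_in_kind E C (THE S. substance E C S)"
proof -
  have "\<exists>S. substance E C S"
    using post_fixed_set_in_substance[OF assms(1,3), of "{}"] by blast
  moreover have "S = S'" if "substance E C S" "substance E C S'" for S S'
    using substances_in_common_substance[OF assms(1,3) that]
      substance_eq_of_subset[OF assms(2,4)] that by metis
  ultimately have unique: "\<exists>!S. substance E C S"
    by blast
  then have "infinite_in_kind E C (THE S. substance E C S)"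
    unfolding infinite_in_kind_def by (metis theI')
  with unique show ?thesis ..
qed

end
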